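(* Let $\mathfrak{A}$ be a residuated lattice. The following assertions are equivalent: (1) $\mathfrak{A}$ is Gelfand; (2) $Max_{h}(\mathfrak{A})$ is a retract of $Spec_{h}(\mathfrak{A})$, i.e. there exists a continuous map $f: Spec_{h}(\mathfrak{A})\to Max_{h}(\mathfrak{A})$ with $f(\mathfrak{m})=\mathfrak{m}$ for every maximal filter $\mathfrak{m}$ of $\mathfrak{A}$.
   Context: A residuated lattice is an algebra $\mathfrak{A}=(A;\vee,\wedge,\odot,\rightarrow,0,1)$ such that $(A;\vee,\wedge,0,1)$ is a bounded lattice, $(A;\odot,1)$ is a commutative monoid, and $x\odot y\le z$ iff $x\le y\rightarrow z$ for all $x,y,z\in A$. A filter of $\mathfrak{A}$ is a non-empty subset $F\subseteq A$ such that $x,y\in F$ implies $x\odot y\in F$, and $x\in F$, $y\in A$ imply $x\vee y\in F$. A filter is proper if it is not $A$; a maximal filter is a maximal element (under inclusion) among proper filters; a prime filter is a proper filter $\mathfrak{p}$ such that $x\vee y\in\mathfrak{p}$ implies $x\in\mathfrak{p}$ or $y\in\mathfrak{p}$. $Spec(\mathfrak{A})$ and $Max(\mathfrak{A})$ are the sets of prime and maximal filters; $Max(\mathfrak{A})\subseteq Spec(\mathfrak{A})$. $\mathfrak{A}$ is Gelfand if every prime filter is contained in a unique maximal filter. $Spec_h(\mathfrak{A})$ is $Spec(\mathfrak{A})$ with the hull-kernel topology, whose closed basis is $\{h(x)\mid x\in A\}$, where $h(x)=\{\mathfrak{p}\in Spec(\mathfrak{A})\mid x\in\mathfrak{p}\}$.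 $Max_h(\mathfrak{A})$ is $Max(\mathfrak{A})$ with the topology with closed basis $\{h(x)\cap Max(\mathfrak{A})\mid x\in A\}$ (the subspace topology). *)

theory Defs
  imports "HOL-Analysis.Analysis"
begin

text \<open>
  The underlying set of a residuated lattice is the whole type, with \<^term>\<open>bot\<close> for $0$ and
  \<^term>\<open>top\<close> for $1$.  The degenerate case $0 = 1$ is allowed.  The residuum is written
  \<open>\<leadsto>\<close>, since \<open>\<rightarrow>\<close> is taken by the function spaces of \<^theory>\<open>HOL-Library.FuncSet\<close>.
\<close>

class residuated_lattice = bounded_lattice +
  fixes odot :: "'a \<Rightarrow> 'a \<Rightarrow> 'a"  (infixl \<open>\<odot>\<close> 70)
    and residuum :: "'a \<Rightarrow> 'a \<Rightarrow> 'a"  (infixr \<open>\<leadsto>\<close> 60)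
  assumes odot_assoc: "(x \<odot> y) \<odot> z = x \<odot> (y \<odot> z)"
    and odot_commute: "x \<odot> y = y \<odot> x"
    and odot_top: "x \<odot> top = x"
    and residuation: "x \<odot> y \<le> z \<longleftrightarrow> x \<le> y \<leadsto> z"

definition rl_filter :: "'a::residuated_lattice set \<Rightarrow> bool" where
  "rl_filter F \<longleftrightarrow>
     F \<noteq> {} \<and> (\<forall>x\<in>F. \<forall>y\<in>F. x \<odot> y \<in> F) \<and> (\<forall>x\<in>F. \<forall>y. sup x y \<in> F)"

definition proper_filter :: "'a::residuated_lattice set \<Rightarrow> bool" where
  "proper_filter F \<longleftrightarrow> rl_filter F \<and> F \<noteq> UNIV"

definition Max_filters :: "'a::residuated_lattice set set" where
  "Max_filters = {M. proper_filter M \<and> (\<forall>F. proper_filter F \<and> M \<subseteq> F \<longrightarrow> F = M)}"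

definition Spec :: "'a::residuated_lattice set set" where
  "Spec = {P. proper_filter P \<and> (\<forall>x y. sup x y \<in> P \<longrightarrow> x \<in> P \<or> y \<in> P)}"

definition gelfand :: "'a::residuated_lattice itself \<Rightarrow> bool" where
  "gelfand _ \<longleftrightarrow> (\<forall>P\<in>(Spec :: 'a set set). \<exists>!M. M \<in> Max_filters \<and> P \<subseteq> M)"

definition hull_of :: "'a::residuated_lattice \<Rightarrow> 'a set set" where
  "hull_of x = {P \<in> Spec. x \<in> P}"

text \<open>
  The sets \<^term>\<open>hull_of x\<close> form a basis of closed sets, so the open sets are the unions of their
  complements; see \<open>closedin_Spec_h\<close> below.
\<close>

definition Spec_h :: "'a::residuated_lattice set topology" where
  "Spec_h = topology (arbitrary union_of (\<lambda>U. \<exists>x. U = Spec - hull_of x))"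

lemma hull_of_sup: "hull_of (sup x y) = hull_of x \<union> hull_of y"
proof -
  have "sup x y \<in> P \<longleftrightarrow> x \<in> P \<or> y \<in> P" if "P \<in> Spec" for P :: "'a set"
  proof -
    have up: "sup a b \<in> P" if "a \<in> P" for a b
      using \<open>P \<in> Spec\<close> that by (simp add: Spec_def proper_filter_def rl_filter_def)
    have prime: "x \<in> P \<or> y \<in> P" if "sup x y \<in> P"
      using \<open>P \<in> Spec\<close> that by (simp add: Spec_def)
    show ?thesis
      using up[of x y] up[of y x] prime by (auto simp: sup.commute)
  qed
  then show ?thesis
    unfolding hull_of_def by blast
qed

lemma hull_of_bot: "hull_of (bot :: 'a::residuated_lattice) = {}"
proof -
  have "z \<in> P" if "rl_filter P" "bot \<in> P" for z and P :: "'a set"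
  proof -
    have "sup bot z \<in> P" using that unfolding rl_filter_def by blast
    then show ?thesis by simp
  qed
  then show ?thesis
    by (auto simp: hull_of_def Spec_def proper_filter_def)
qed

lemma openin_Spec_h:
  "openin Spec_h = arbitrary union_of (\<lambda>U. \<exists>x. U = Spec - hull_of x)"
proof -
  have "istopology (arbitrary union_of (\<lambda>U. \<exists>x::'a. U = Spec - hull_of x))"
  proof (rule istopology_base)
    fix S T :: "'a set set"
    assume "\<exists>x. S = Spec - hull_of x" "\<exists>x. T = Spec - hull_of x"
    then obtain x y where "S = Spec - hull_of x" "T = Spec - hull_of y" by blast
    then have "S \<inter> T = Spec - hull_of (sup x y)" by (auto simp: hull_of_sup)
    then show "\<exists>x. S \<inter> T = Spec - hull_of x" ..
  qed
  then show ?thesis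
    by (simp add: Spec_h_def topology_inverse')
qed

lemma topspace_Spec_h: "topspace (Spec_h :: 'a::residuated_lattice set topology) = Spec"
proof
  have "openin Spec_h (Spec - hull_of (bot :: 'a))"
    unfolding openin_Spec_h by (rule union_of_inc) (auto simp: arbitrary_def)
  then show "Spec \<subseteq> topspace (Spec_h :: 'a set topology)"
    by (simp add: hull_of_bot openin_subset)
  show "topspace (Spec_h :: 'a set topology) \<subseteq> Spec"
    unfolding topspace_def openin_Spec_h by (auto simp: union_of_def)
qed

lemma closedin_Spec_h:
  "closedin Spec_h C \<longleftrightarrow> (\<exists>X :: 'a::residuated_lattice set. C = Spec \<inter> (\<Inter>x\<in>X. hull_of x))"
proof
  assume C: "closedin Spec_h C"
  then have "openin Spec_h (Spec - C)"
    by (simp add: closedin_def topspace_Spec_h)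
  then obtain \<U> where U: "\<U> \<subseteq> {U. \<exists>x. U = Spec - hull_of x}" "\<Union>\<U> = Spec - C"
    by (auto simp: openin_Spec_h union_of_def)
  have sub: "C \<subseteq> Spec"
    using C closedin_subset topspace_Spec_h by blast
  define X where "X = {x. Spec - hull_of x \<in> \<U>}"
  have "\<U> = (\<lambda>x. Spec - hull_of x) ` X"
  proof
    show "\<U> \<subseteq> (\<lambda>x. Spec - hull_of x) ` X"
    proof
      fix U assume "U \<in> \<U>"
      moreover from this obtain x where "U = Spec - hull_of x"
        using U(1) by auto
      ultimately show "U \<in> (\<lambda>x. Spec - hull_of x) ` X"
        by (simp add: X_def)
    qed
    show "(\<lambda>x. Spec - hull_of x) ` X \<subseteq> \<U>"
      by (simp add: X_def image_subset_iff)
  qed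
  then have "Spec - C = Spec - (\<Inter>x\<in>X. hull_of x)"
    using U(2) by auto
  with sub have "C = Spec \<inter> (\<Inter>x\<in>X. hull_of x)" by blast
  then show "\<exists>X. C = Spec \<inter> (\<Inter>x\<in>X. hull_of x)" ..
next
  assume "\<exists>X. C = Spec \<inter> (\<Inter>x\<in>X. hull_of x)"
  then obtain X where C: "C = Spec \<inter> (\<Inter>x\<in>X. hull_of x)" ..
  then have eq: "Spec - C = (\<Union>x\<in>X. Spec - hull_of x)" by auto
  have "openin Spec_h (Spec - hull_of x)" for x :: 'a
    unfolding openin_Spec_h by (rule union_of_inc) (auto simp: arbitrary_def)
  then have "openin Spec_h (Spec - C)"
    unfolding eq by (intro openin_Union) blast
  then show "closedin Spec_h C"
    using C by (auto simp: closedin_def topspace_Spec_h)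
qed

lemma Max_filters_subset_Spec: "(Max_filters :: 'a::residuated_lattice set set) \<subseteq> Spec"
proof
  fix M :: "'a set"
  assume M: "M \<in> Max_filters"
  then have mult: "x \<odot> y \<in> M" if "x \<in> M" "y \<in> M" for x y
    using that by (auto simp: Max_filters_def proper_filter_def rl_filter_def)
  have up: "y \<in> M" if "x \<in> M" "x \<le> y" for x y
  proof -
    have "sup x y \<in> M"
      using M that(1) unfolding Max_filters_def proper_filter_def rl_filter_def by blast
    with that(2) show ?thesis by (simp add: sup.absorb2)
  qed
  have mono: "a \<odot> c \<le> b \<odot> c" if "a \<le> b" for a b c :: 'a
  proof -
    have "b \<le> c \<leadsto> b \<odot> c" by (simp flip: residuation)
    with that show ?thesis unfolding residuation by (rule order.trans)
  qed
  have sup_le: "sup a b \<odot> c \<le> z" if "a \<odot> c \<le> z" "b \<odot> c \<le> z" for a b c z :: 'a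
    using that by (auto simp: residuation)
  have right: "a \<odot> b \<le> a" for a b :: 'a
    by (metis mono odot_commute odot_top top_greatest)
  have dist: "sup z x \<odot> sup w x \<le> sup (z \<odot> w) x" for z w x :: 'a
  proof -
    have "w \<odot> z \<le> sup (z \<odot> w) x"
      by (subst odot_commute) (rule sup_ge1)
    moreover have "x \<odot> c \<le> sup (z \<odot> w) x" for c
      using right le_supI2 by blast
    ultimately have "sup w x \<odot> z \<le> sup (z \<odot> w) x"
      by (intro sup_le)
    then have "z \<odot> sup w x \<le> sup (z \<odot> w) x"
      by (subst odot_commute)
    then show ?thesis
      using \<open>\<And>c. x \<odot> c \<le> sup (z \<odot> w) x\<close> by (intro sup_le)
  qed
  have "x \<in> M \<or> y \<in> M" if xy: "sup x y \<in> M" for x y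
  proof (rule ccontr)
    assume neg: "\<not> (x \<in> M \<or> y \<in> M)"
    define F where "F = {z. sup z x \<in> M}"
    have "M \<subseteq> F" "y \<in> F" "bot \<notin> F"
      using xy neg by (auto simp: F_def sup.commute intro: up)
    moreover have "z \<odot> w \<in> F" if "z \<in> F" "w \<in> F" for z w
      using that mult dist up unfolding F_def by blast
    moreover have "sup z w \<in> F" if "z \<in> F" for z w
    proof -
      have "sup z x \<le> sup (sup z w) x" by (simp add: le_supI1)
      then show ?thesis using that up unfolding F_def by blast
    qed
    ultimately have "proper_filter F"
      by (auto simp: proper_filter_def rl_filter_def)
    with \<open>M \<subseteq> F\<close> M have "F = M" by (simp add: Max_filters_def)
    with \<open>y \<in> F\<close> neg show False by simp
  qed
  with M show "M \<in> Spec"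
    by (simp add: Spec_def Max_filters_def)
qed

abbreviation Max_h :: "'a::residuated_lattice set topology" where
  "Max_h \<equiv> subtopology Spec_h Max_filters"

lemma closedin_Max_h:
  "closedin Max_h C \<longleftrightarrow>
     (\<exists>X :: 'a::residuated_lattice set. C = Max_filters \<inter> (\<Inter>x\<in>X. hull_of x \<inter> Max_filters))"
proof -
  have "Spec \<inter> (\<Inter>x\<in>X. hull_of x) \<inter> Max_filters = Max_filters \<inter> (\<Inter>x\<in>X. hull_of x \<inter> Max_filters)"
    for X :: "'a set"
    using Max_filters_subset_Spec by blast
  then show ?thesis
    unfolding closedin_subtopology closedin_Spec_h by metis
qed

lemma Max_filters_retract_iff:
  "(Max_filters :: 'a::residuated_lattice set set) retract_of_space Spec_h \<longleftrightarrow>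
     (\<exists>f :: 'a set \<Rightarrow> 'a set. continuous_map Spec_h Max_h f \<and> (\<forall>M\<in>Max_filters. f M = M))"
  by (simp add: retract_of_space_def topspace_Spec_h Max_filters_subset_Spec)

end

theory Submission
  imports Defs
begin

text \<open>
  If \<open>f\<close> is a retraction onto the maximal filters, then each fibre of \<open>f\<close> is closed, because the
  maximal filters are closed points of \<^term>\<open>Max_h\<close>.  Closed sets of prime filters are closed under
  passing to larger prime filters, so every maximal \<open>M \<supseteq> P\<close> lies in the fibre of \<open>f P\<close>, whence
  \<open>M = f M = f P\<close>: there is only one such \<open>M\<close>.

  Conversely, let \<open>f\<close> send each prime filter to the unique maximal filter above it.  To see that \<open>f\<close> is
  continuous, take a closed set \<open>C\<close> of maximal filters and a prime filter \<open>Q\<close> in the closure of the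
  preimage of \<open>C\<close>, that is, \<open>\<Inter>(f -` C) \<subseteq> Q\<close>.  It is enough to find a prime filter \<open>P\<close> that lies both
  below \<open>Q\<close> and below some member \<open>M\<close> of \<open>C\<close>, for then \<open>f Q = f P = M\<close>.  The joins \<open>sup s t\<close> with
  \<open>s \<notin> Q\<close> and \<open>t\<close> outside every member of \<open>C\<close> form a join-closed set that omits \<^term>\<open>top\<close>, so the
  prime filter theorem (\<open>prime_filter_avoiding\<close>) gives a prime \<open>P\<close> with \<open>P \<subseteq> Q\<close> and \<open>P \<subseteq> \<Union>C\<close>.
  Being covered by \<open>C\<close>, the filter \<open>P\<close> generates a proper filter together with \<open>\<Inter>C\<close>; a maximal
  filter above this one belongs to \<open>C\<close>, since \<open>C\<close> is closed, and contains \<open>P\<close>.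
\<close>

section \<open>Filters of a residuated lattice\<close>

lemma odot_mono:
  fixes a b c d :: "'a::residuated_lattice"
  assumes "a \<le> b" "c \<le> d"
  shows "a \<odot> c \<le> b \<odot> d"
proof -
  have *: "x \<odot> z \<le> y \<odot> z" if "x \<le> y" for x y z :: 'a
  proof -
    have "y \<le> z \<leadsto> y \<odot> z" by (simp flip: residuation)
    with that show ?thesis unfolding residuation by (rule order.trans)
  qed
  have "a \<odot> c \<le> b \<odot> c" using assms(1) by (rule *)
  also have "b \<odot> c \<le> b \<odot> d" using *[OF assms(2), of b] by (simp add: odot_commute)
  finally show ?thesis .
qed

lemma odot_le1: "a \<odot> b \<le> (a :: 'a::residuated_lattice)"
  using odot_mono[of a a b top] by (simp add: odot_top)

lemma odot_le2: "a \<odot> b \<le> (b :: 'a::residuated_lattice)"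
  using odot_le1[of b a] by (simp add: odot_commute)

text \<open>
  Multiplication distributes over joins because it is residuated.  Expanding the left-hand side
  therefore gives \<open>z \<odot> w\<close> and three products with a factor \<open>x\<close>, which lie below \<open>x\<close>.
\<close>

lemma sup_odot_sup_le:
  fixes z w x :: "'a::residuated_lattice"
  shows "sup z x \<odot> sup w x \<le> sup (z \<odot> w) x"
proof -
  have sup_le: "sup a b \<odot> c \<le> d" if "a \<odot> c \<le> d" "b \<odot> c \<le> d" for a b c d :: 'a
    using that by (auto simp: residuation)
  have x: "x \<odot> c \<le> sup (z \<odot> w) x" for c
    using odot_le1 le_supI2 by blast
  have "w \<odot> z \<le> sup (z \<odot> w) x"
    by (subst odot_commute) (rule sup_ge1)
  then have "sup w x \<odot> z \<le> sup (z \<odot> w) x"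
    using x by (rule sup_le)
  then have "z \<odot> sup w x \<le> sup (z \<odot> w) x"
    by (subst odot_commute)
  then show ?thesis
    using x by (rule sup_le)
qed

lemma rl_filter_iff:
  "rl_filter F \<longleftrightarrow> top \<in> F \<and> (\<forall>x\<in>F. \<forall>y\<in>F. x \<odot> y \<in> F) \<and> (\<forall>x\<in>F. \<forall>y. x \<le> y \<longrightarrow> y \<in> F)"
proof
  assume F: "rl_filter F"
  have up: "y \<in> F" if "x \<in> F" "x \<le> y" for x y
    using F that by (metis rl_filter_def sup.absorb2)
  moreover obtain x where "x \<in> F"
    using F by (auto simp: rl_filter_def)
  ultimately show "top \<in> F \<and> (\<forall>x\<in>F. \<forall>y\<in>F. x \<odot> y \<in> F) \<and> (\<forall>x\<in>F. \<forall>y. x \<le> y \<longrightarrow> y \<in> F)"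
    using F top_greatest unfolding rl_filter_def by blast
next
  assume "top \<in> F \<and> (\<forall>x\<in>F. \<forall>y\<in>F. x \<odot> y \<in> F) \<and> (\<forall>x\<in>F. \<forall>y. x \<le> y \<longrightarrow> y \<in> F)"
  then show "rl_filter F"
    unfolding rl_filter_def using sup_ge1 by blast
qed

lemma filter_top: "rl_filter F \<Longrightarrow> top \<in> F"
  and filter_odot: "rl_filter F \<Longrightarrow> x \<in> F \<Longrightarrow> y \<in> F \<Longrightarrow> x \<odot> y \<in> F"
  and filter_up: "rl_filter F \<Longrightarrow> x \<in> F \<Longrightarrow> x \<le> y \<Longrightarrow> y \<in> F"
  by (auto simp: rl_filter_iff)

lemma proper_filter_iff_bot: "proper_filter F \<longleftrightarrow> rl_filter F \<and> bot \<notin> F"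
  unfolding proper_filter_def using filter_up[OF _ _ bot_least] by blast

lemma rl_filter_top: "rl_filter {top}"
  by (simp add: rl_filter_iff odot_top top_unique)

lemma Spec_rl_filter: "P \<in> Spec \<Longrightarrow> rl_filter P"
  by (simp add: Spec_def proper_filter_def)

lemma Spec_sup_iff: "P \<in> Spec \<Longrightarrow> sup x y \<in> P \<longleftrightarrow> x \<in> P \<or> y \<in> P"
  using hull_of_sup[of x y] by (auto simp: hull_of_def)

lemma Max_filters_rl_filter: "M \<in> Max_filters \<Longrightarrow> rl_filter M"
  by (simp add: Max_filters_def proper_filter_def)

lemma bot_notin_Max_filter: "M \<in> Max_filters \<Longrightarrow> bot \<notin> M"
  by (simp add: Max_filters_def proper_filter_iff_bot)

lemma rl_filter_Inter:
  assumes "\<And>F. F \<in> \<F> \<Longrightarrow> rl_filter F"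
  shows "rl_filter (\<Inter>\<F>)"
  using assms unfolding rl_filter_iff by blast

lemma rl_filter_Union_chain:
  assumes "\<C> \<noteq> {}" and chain: "subset.chain \<A> \<C>" and "\<And>F. F \<in> \<C> \<Longrightarrow> rl_filter F"
  shows "rl_filter (\<Union>\<C>)"
proof -
  have "x \<odot> y \<in> \<Union>\<C>" if "x \<in> F" "F \<in> \<C>" "y \<in> G" "G \<in> \<C>" for x y F G
  proof -
    have "F \<subseteq> G \<or> G \<subseteq> F"
      using chain that by (auto simp: subset_chain_def)
    then show ?thesis
      using that assms(3) by (metis UnionI filter_odot subsetD)
  qed
  moreover have "top \<in> \<Union>\<C>"
    using assms(1,3) filter_top by blast
  ultimately show ?thesis
    unfolding rl_filter_iff using assms(3) filter_up by blast
qed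

text \<open>
  This relative annihilator of \<open>x\<close> is closed under \<open>\<odot>\<close> by \<open>sup_odot_sup_le\<close>.  Since it
  extends \<open>F\<close>, it serves in the proof of primeness in place of the filter generated by \<open>F\<close> and one
  more element, whose description would involve powers of that element.
\<close>

lemma rl_filter_sup_residual:
  assumes F: "rl_filter F"
  shows "rl_filter {z. sup z x \<in> F}"
proof -
  have "sup (z \<odot> w) x \<in> F" if "sup z x \<in> F" "sup w x \<in> F" for z w
    using that F sup_odot_sup_le filter_odot filter_up by metis
  moreover have "sup w x \<in> F" if "sup z x \<in> F" "z \<le> w" for z w
    using F that filter_up sup_mono[OF that(2) order_refl] by blast
  ultimately show ?thesis
    using filter_top[OF F] by (auto simp: rl_filter_iff)
qed

text \<open>The smallest filter that contains both \<open>F\<close> and \<open>G\<close>.\<close>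

lemma rl_filter_product:
  assumes F: "rl_filter F" and G: "rl_filter G"
  shows "rl_filter {z. \<exists>x\<in>F. \<exists>y\<in>G. x \<odot> y \<le> z}" (is "rl_filter ?H")
proof -
  have "z \<odot> w \<in> ?H" if "x \<in> F" "y \<in> G" "x \<odot> y \<le> z" "x' \<in> F" "y' \<in> G" "x' \<odot> y' \<le> w"
    for x y z x' y' w
  proof -
    have "(x \<odot> x') \<odot> (y \<odot> y') = (x \<odot> y) \<odot> (x' \<odot> y')"
      by (metis odot_assoc odot_commute)
    also have "\<dots> \<le> z \<odot> w"
      using that by (intro odot_mono)
    finally show ?thesis
      using that filter_odot[OF F] filter_odot[OF G] by blast
  qed
  moreover have "top \<in> ?H"
    using filter_top[OF F] filter_top[OF G] top_greatest by blast
  ultimately show ?thesis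
    unfolding rl_filter_iff by (auto intro: order.trans)
qed

section \<open>Existence of maximal and prime filters\<close>

lemma maximal_filter_avoiding:
  assumes F: "rl_filter F" "F \<inter> S = {}"
  obtains G where "rl_filter G" "F \<subseteq> G" "G \<inter> S = {}"
    and "\<And>H. rl_filter H \<Longrightarrow> G \<subseteq> H \<Longrightarrow> H \<inter> S = {} \<Longrightarrow> H = G"
proof -
  define \<A> where "\<A> = {G. rl_filter G \<and> F \<subseteq> G \<and> G \<inter> S = {}}"
  have "\<A> \<noteq> {}"
    using F by (auto simp: \<A>_def)
  moreover have "\<Union>\<C> \<in> \<A>" if "\<C> \<noteq> {}" and chain: "subset.chain \<A> \<C>" for \<C>
  proof -
    have C: "\<C> \<subseteq> \<A>"
      using chain by (simp add: subset_chain_def)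
    then have "rl_filter (\<Union>\<C>)"
      using rl_filter_Union_chain[OF that] by (auto simp: \<A>_def)
    then show ?thesis
      using C \<open>\<C> \<noteq> {}\<close> unfolding \<A>_def by blast
  qed
  ultimately obtain G where "G \<in> \<A>" and max: "\<And>H. H \<in> \<A> \<Longrightarrow> G \<subseteq> H \<Longrightarrow> H = G"
    using subset_Zorn_nonempty[of \<A>] by blast
  then have G: "rl_filter G" "F \<subseteq> G" "G \<inter> S = {}"
    by (auto simp: \<A>_def)
  moreover have "H = G" if "rl_filter H" "G \<subseteq> H" "H \<inter> S = {}" for H
    using max[of H] that G by (auto simp: \<A>_def)
  ultimately show thesis
    by (rule that)
qed

lemma proper_filter_le_Max:
  assumes "proper_filter F"
  obtains M where "M \<in> Max_filters" "F \<subseteq> M"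
proof -
  have "rl_filter F" "F \<inter> {bot} = {}"
    using assms by (auto simp: proper_filter_iff_bot)
  then obtain G where "rl_filter G" "F \<subseteq> G" "G \<inter> {bot} = {}"
    "\<And>H. rl_filter H \<Longrightarrow> G \<subseteq> H \<Longrightarrow> H \<inter> {bot} = {} \<Longrightarrow> H = G"
    by (rule maximal_filter_avoiding) blast
  then have "G \<in> Max_filters"
    by (auto simp: Max_filters_def proper_filter_iff_bot)
  with \<open>F \<subseteq> G\<close> show thesis
    by (rule that[rotated])
qed

text \<open>
  Let \<open>G\<close> be maximal among the filters avoiding \<open>S\<close> and \<open>sup a b \<in> G\<close>, with neither \<open>a\<close> nor \<open>b\<close> in
  \<open>G\<close>.  The relative annihilator of \<open>a\<close> contains \<open>b\<close>, so it meets \<open>S\<close> in some \<open>s\<close>; that of \<open>s\<close>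
  contains \<open>a\<close>, so it meets \<open>S\<close> in some \<open>t\<close>.  But then \<open>sup t s\<close> lies in both \<open>G\<close> and \<open>S\<close>.
\<close>

lemma prime_filter_avoiding:
  assumes F: "rl_filter F" "F \<inter> S = {}" and "S \<noteq> {}"
    and S: "\<And>s t. s \<in> S \<Longrightarrow> t \<in> S \<Longrightarrow> sup s t \<in> S"
  obtains P where "P \<in> Spec" "F \<subseteq> P" "P \<inter> S = {}"
proof -
  obtain G where G: "rl_filter G" "F \<subseteq> G" "G \<inter> S = {}"
    and max: "\<And>H. rl_filter H \<Longrightarrow> G \<subseteq> H \<Longrightarrow> H \<inter> S = {} \<Longrightarrow> H = G"
    using maximal_filter_avoiding[OF F] by metis
  have meets: "\<exists>s\<in>S. sup s x \<in> G" if "sup y x \<in> G" "y \<notin> G" for x y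
  proof -
    have "G \<subseteq> {z. sup z x \<in> G}"
      using filter_up[OF G(1)] by auto
    moreover have "{z. sup z x \<in> G} \<noteq> G"
      using that by blast
    ultimately show ?thesis
      using max[OF rl_filter_sup_residual[OF G(1), of x]] by blast
  qed
  have "a \<in> G \<or> b \<in> G" if ab: "sup a b \<in> G" for a b
  proof (rule ccontr)
    assume neg: "\<not> (a \<in> G \<or> b \<in> G)"
    then obtain s where s: "s \<in> S" "sup s a \<in> G"
      using meets[of b a] ab by (auto simp: sup.commute)
    then obtain t where "t \<in> S" "sup t s \<in> G"
      using meets[of a s] neg by (auto simp: sup.commute)
    then show False
      using S s G(3) by blast
  qed
  moreover have "proper_filter G"
    using G \<open>S \<noteq> {}\<close> by (auto simp: proper_filter_def)
  ultimately have "G \<in> Spec"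
    by (simp add: Spec_def)
  then show thesis
    using G by (intro that)
qed

section \<open>Closed sets of prime and maximal filters\<close>

lemma closedin_Spec_h_upward:
  assumes "closedin Spec_h C" "P \<in> C" "P \<subseteq> Q" "Q \<in> Spec"
  shows "Q \<in> C"
  using assms by (auto simp: closedin_Spec_h hull_of_def)

lemma closedin_Spec_h_hull_kernel:
  "closedin Spec_h {Q \<in> Spec. D \<subseteq> Q}"
proof -
  have "{Q \<in> Spec. D \<subseteq> Q} = Spec \<inter> (\<Inter>x\<in>D. hull_of x)"
    by (auto simp: hull_of_def)
  then show ?thesis
    unfolding closedin_Spec_h by blast
qed

lemma closedin_Max_h_Inter_le:
  assumes "closedin Max_h C" "M \<in> Max_filters" "\<Inter>C \<subseteq> M"
  shows "M \<in> C"
proof -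
  obtain X where C: "C = Max_filters \<inter> (\<Inter>x\<in>X. hull_of x \<inter> Max_filters)"
    using assms(1) unfolding closedin_Max_h by blast
  then have "X \<subseteq> \<Inter>C"
    by (auto simp: hull_of_def)
  then have "X \<subseteq> M"
    using assms(3) by blast
  then show ?thesis
    using assms(2) Max_filters_subset_Spec unfolding C hull_of_def by blast
qed

lemma closedin_Max_h_singleton:
  assumes "M \<in> Max_filters"
  shows "closedin Max_h {M}"
proof -
  have "N = M" if "N \<in> Max_filters" "M \<subseteq> N" for N
    using assms that by (auto simp: Max_filters_def)
  then have "{M} = {Q \<in> Spec. M \<subseteq> Q} \<inter> Max_filters"
    using assms Max_filters_subset_Spec by blast
  then show ?thesis
    using closedin_Spec_h_hull_kernel closedin_subtopology by metis
qed

section \<open>The retraction of a Gelfand residuated lattice\<close>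

text \<open>
  The algebraic core of continuity: a prime filter in the closure of the set of primes below
  members of \<open>C\<close> itself contains a prime of this kind.
\<close>

lemma prime_below_closed_set:
  fixes Q :: "'a::residuated_lattice set"
  assumes C: "closedin Max_h C" and Q: "Q \<in> Spec"
    and D: "\<Inter>{P \<in> Spec. \<exists>M\<in>C. P \<subseteq> M} \<subseteq> Q"
  obtains P M where "P \<in> Spec" "P \<subseteq> Q" "M \<in> C" "P \<subseteq> M"
proof -
  have CMax: "C \<subseteq> Max_filters"
    using closedin_subset[OF C] by (simp add: topspace_subtopology)
  define S where "S = {sup s t | s t. s \<notin> Q \<and> t \<notin> \<Union>C}"
  have bot: "bot \<notin> Q" "bot \<notin> \<Union>C"
    using Q CMax bot_notin_Max_filter by (auto simp: Spec_def proper_filter_iff_bot)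
  \<comment> \<open>As \<^term>\<open>bot\<close> may stand for either joinand, avoiding \<open>S\<close> forces a filter below both \<open>Q\<close> and \<open>\<Union>C\<close>.\<close>
  have S1: "s \<in> S" if "s \<notin> Q" for s
    unfolding S_def by (rule CollectI, intro exI[of _ s] exI[of _ bot]) (use that bot in simp)
  have S2: "t \<in> S" if "t \<notin> \<Union>C" for t
    unfolding S_def by (rule CollectI, intro exI[of _ bot] exI[of _ t]) (use that bot in simp)
  have top: "{top} \<inter> S = {}"
  proof (rule ccontr)
    assume "{top} \<inter> S \<noteq> {}"
    then have "top \<in> S" by simp
    then obtain s t where st: "sup s t = top" "s \<notin> Q" "t \<notin> \<Union>C"
      unfolding S_def by (auto dest: sym)
    \<comment> \<open>A prime below a member of \<open>C\<close> omits \<open>t\<close>, so it must contain \<open>s\<close>; the kernel condition then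
      puts \<open>s\<close> into \<open>Q\<close>.\<close>
    have "s \<in> P" if "P \<in> Spec" "M \<in> C" "P \<subseteq> M" for P M
    proof -
      have "sup s t \<in> P"
        using st(1) filter_top[OF Spec_rl_filter[OF that(1)]] by simp
      then show ?thesis
        using Spec_sup_iff[OF that(1)] st(3) that by blast
    qed
    then show False
      using D st(2) by blast
  qed
  have join: "sup u v \<in> S" if "u \<in> S" "v \<in> S" for u v
  proof -
    obtain s t s' t' where "u = sup s t" "v = sup s' t'"
      and out: "s \<notin> Q" "t \<notin> \<Union>C" "s' \<notin> Q" "t' \<notin> \<Union>C"
      using \<open>u \<in> S\<close> \<open>v \<in> S\<close> unfolding S_def by blast
    then have "sup u v = sup (sup s s') (sup t t')"
      by (simp add: ac_simps)
    moreover have "sup s s' \<notin> Q"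
      using Spec_sup_iff[OF Q] out by blast
    moreover have "sup t t' \<notin> \<Union>C"
      using Spec_sup_iff CMax Max_filters_subset_Spec out by blast
    ultimately show ?thesis
      unfolding S_def by blast
  qed
  have "S \<noteq> {}"
    using S1 bot by blast
  then obtain P where P: "P \<in> Spec" "P \<inter> S = {}"
    using prime_filter_avoiding[OF rl_filter_top top] join by metis
  then have PQ: "P \<subseteq> Q" and PC: "P \<subseteq> \<Union>C"
    using S1 S2 by blast+
  \<comment> \<open>\<open>P \<subseteq> \<Union>C\<close> does not yet put \<open>P\<close> below a single member of \<open>C\<close>.  Adjoining \<open>\<Inter>C\<close> does: any maximal
    filter above the result lies in the closed set \<open>C\<close>.\<close>
  define H where "H = {z. \<exists>x\<in>P. \<exists>y\<in>\<Inter>C. x \<odot> y \<le> z}"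
  have filters: "rl_filter P" "rl_filter (\<Inter>C)"
    using P Spec_rl_filter rl_filter_Inter CMax Max_filters_rl_filter by blast+
  have "x \<odot> y \<noteq> bot" if "x \<in> P" "y \<in> \<Inter>C" for x y
  proof -
    obtain M where M: "M \<in> C" "x \<in> M"
      using PC \<open>x \<in> P\<close> by blast
    then have "rl_filter M" "y \<in> M"
      using that CMax Max_filters_rl_filter by auto
    then have "x \<odot> y \<in> M"
      using M(2) by (intro filter_odot)
    then show ?thesis
      using M(1) bot(2) by auto
  qed
  then have "proper_filter H"
    using rl_filter_product[OF filters] by (auto simp: H_def proper_filter_iff_bot bot_unique)
  then obtain M where M: "M \<in> Max_filters" "H \<subseteq> M"
    by (rule proper_filter_le_Max)
  have "P \<subseteq> H" "\<Inter>C \<subseteq> H"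
    unfolding H_def
    using odot_le1 odot_le2 filter_top[OF filters(1)] filter_top[OF filters(2)] by (fast, fast)
  then have "P \<subseteq> M" "M \<in> C"
    using M closedin_Max_h_Inter_le[OF C] by blast+
  then show thesis
    using that P PQ by blast
qed

lemma continuous_map_maximal_filter_above:
  fixes f :: "'a::residuated_lattice set \<Rightarrow> 'a set"
  assumes above: "\<And>P. P \<in> Spec \<Longrightarrow> f P \<in> Max_filters \<and> P \<subseteq> f P"
    and unique: "\<And>P M. P \<in> Spec \<Longrightarrow> M \<in> Max_filters \<Longrightarrow> P \<subseteq> M \<Longrightarrow> f P = M"
  shows "continuous_map Spec_h Max_h f"
  unfolding continuous_map_closedin
proof (intro conjI allI impI Pi_I)
  fix P :: "'a set"
  assume "P \<in> topspace Spec_h"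
  then show "f P \<in> topspace Max_h"
    using above Max_filters_subset_Spec by (auto simp: topspace_Spec_h topspace_subtopology)
next
  fix C :: "'a set set"
  assume C: "closedin Max_h C"
  have CMax: "C \<subseteq> Max_filters"
    using closedin_subset[OF C] by (simp add: topspace_subtopology)
  let ?D = "\<Inter>{P \<in> Spec. \<exists>M\<in>C. P \<subseteq> M}"
  have "f Q \<in> C \<longleftrightarrow> ?D \<subseteq> Q" if Q: "Q \<in> Spec" for Q
  proof
    assume "f Q \<in> C"
    then show "?D \<subseteq> Q"
      using above[OF Q] Q by blast
  next
    assume "?D \<subseteq> Q"
    then obtain P M where PM: "P \<in> Spec" "P \<subseteq> Q" "M \<in> C" "P \<subseteq> M"
      using prime_below_closed_set[OF C Q] by blast
    have "f P = M"
      using unique PM CMax by blast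
    moreover have "f P = f Q"
      using unique PM(1,2) above[OF Q] by blast
    ultimately show "f Q \<in> C"
      using PM(3) by simp
  qed
  then have "{Q \<in> topspace Spec_h. f Q \<in> C} = {Q \<in> Spec. ?D \<subseteq> Q}"
    by (auto simp: topspace_Spec_h)
  then show "closedin Spec_h {Q \<in> topspace Spec_h. f Q \<in> C}"
    by (simp only: closedin_Spec_h_hull_kernel)
qed

theorem theorem3p9:
  shows "gelfand TYPE('a::residuated_lattice) \<longleftrightarrow>
    (Max_filters :: 'a set set) retract_of_space Spec_h"
proof
  assume G: "gelfand TYPE('a)"
  define f :: "'a set \<Rightarrow> 'a set" where "f P = (THE M. M \<in> Max_filters \<and> P \<subseteq> M)" for P
  have ex1: "\<exists>!M. M \<in> Max_filters \<and> P \<subseteq> M" if "P \<in> Spec" for P :: "'a set"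
    using G that by (auto simp: gelfand_def)
  have above: "f P \<in> Max_filters \<and> P \<subseteq> f P" if "P \<in> Spec" for P
    unfolding f_def using ex1[OF that] by (rule theI')
  have unique: "f P = M" if "P \<in> Spec" "M \<in> Max_filters" "P \<subseteq> M" for P M
    using ex1[OF that(1)] above[OF that(1)] that by blast
  have "f M = M" if "M \<in> Max_filters" for M
    using that Max_filters_subset_Spec by (intro unique) auto
  moreover have "continuous_map Spec_h Max_h f"
    using above unique by (rule continuous_map_maximal_filter_above)
  ultimately show "(Max_filters :: 'a set set) retract_of_space Spec_h"
    unfolding Max_filters_retract_iff by blast
next
  assume "(Max_filters :: 'a set set) retract_of_space Spec_h"
  then obtain f :: "'a set \<Rightarrow> 'a set" where f: "continuous_map Spec_h Max_h f"
    and retr: "\<And>M. M \<in> Max_filters \<Longrightarrow> f M = M"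
    unfolding Max_filters_retract_iff by blast
  show "gelfand TYPE('a)"
    unfolding gelfand_def
  proof
    fix P :: "'a set"
    assume P: "P \<in> Spec"
    then have "proper_filter P"
      by (simp add: Spec_def)
    then obtain M where M: "M \<in> Max_filters" "P \<subseteq> M"
      by (rule proper_filter_le_Max)
    have "f P \<in> Max_filters"
      using f P by (auto simp: continuous_map_def topspace_Spec_h topspace_subtopology)
    then have fibre: "closedin Spec_h {Q \<in> topspace Spec_h. f Q \<in> {f P}}"
      by (intro closedin_continuous_map_preimage[OF f] closedin_Max_h_singleton)
    have "f P = N" if N: "N \<in> Max_filters" "P \<subseteq> N" for N
    proof -
      have "N \<in> {Q \<in> topspace Spec_h. f Q \<in> {f P}}"
        using fibre
      proof (rule closedin_Spec_h_upward)
        show "P \<in> {Q \<in> topspace Spec_h. f Q \<in> {f P}}"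
          using P by (simp add: topspace_Spec_h)
      qed (use N Max_filters_subset_Spec in auto)
      then show ?thesis
        using retr[OF N(1)] by simp
    qed
    then show "\<exists>!M. M \<in> Max_filters \<and> P \<subseteq> M"
      using M by (intro ex1I[of _ M]) auto
  qed
qed

end
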